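(* Let $d\ge 2$ be an integer, $p=d-1$, $\lambda>0$ and $u>0$, and let $\mathbf N\sim\mathrm{NDFHL}^{(d)}(\lambda,u)$. For $P>0$ define the capacity $$C(P)=\sup_{P_{\mathbf X}:\ \mathbb E\|\mathbf X\|^2\le P} I(\mathbf X;\mathbf X+\mathbf N),$$ where the supremum is over distributions of $\mathbf X\in\mathbb R^p$ independent of $\mathbf N$. Then $$C(P)=\frac{p}{2}\log P+O(1),\qquad P\to\infty.$$
   Context: For an integer $d\ge2$, $p=d-1$, $\lambda>0$, $u>0$, the distribution $\mathrm{NDFHL}^{(d)}(\lambda,u)$ is the probability law on $\mathbb R^{p}$ with density $$f_{\mathbf N}(\mathbf n)=\frac{\lambda}{2^{\frac d2-1}\pi^{\frac d2}}\left(\frac{u}{\rho(\mathbf n)}\right)^{\frac d2}e^{\lambda u}K_{\frac d2}\bigl(u\rho(\mathbf n)\bigr),\qquad \rho(\mathbf n)=\sqrt{\|\mathbf n\|^2+\lambda^2},$$ where $K_\nu$ is the modified Bessel function of the second kind. Equivalently, it is the law of $\sigma\sqrt{T}\,\mathbf Z$ where $\sigma>0$, $\mathbf Z\sim\mathcal N(\mathbf 0,\mathbf I_p)$ is independent of $T$, and $T$ is inverse Gaussian with mean $\lambda/(u\sigma^2)$ and shape parameter $\lambda^2/\sigma^2$. All logarithms are natural; $I(\cdot;\cdot)$ denotes mutual information. *)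

theory Defs
  imports "HOL-Probability.Probability" "HOL-Library.Landau_Symbols"
begin

text \<open>Modified Bessel function of the second kind, via the standard integral
  representation K_nu(x) = int_0^infty exp(-x cosh t) cosh(nu t) dt  (x > 0).\<close>
definition besselK :: "real \<Rightarrow> real \<Rightarrow> real" where
  "besselK \<nu> x = (LINT t:{0..}|lborel. exp (- x * cosh t) * cosh (\<nu> * t))"

definition ndfhl_density :: "nat \<Rightarrow> real \<Rightarrow> real \<Rightarrow> real \<Rightarrow> real" where
  "ndfhl_density d lam u r =
     (let \<rho> = sqrt (r\<^sup>2 + lam\<^sup>2) in
      lam / (2 powr (real d / 2 - 1) * pi powr (real d / 2))
        * (u / \<rho>) powr (real d / 2) * exp (lam * u) * besselK (real d / 2) (u * \<rho>))"

text \<open>The law NDFHL^(d)(lam,u) on R^p, p = d - 1 (realised as real^'n with CARD('n) = d - 1).\<close>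
definition NDFHL :: "nat \<Rightarrow> real \<Rightarrow> real \<Rightarrow> (real^'n) measure" where
  "NDFHL d lam u = density lborel (\<lambda>n. ennreal (ndfhl_density d lam u (norm n)))"

definition input_laws :: "real \<Rightarrow> (real^'n) measure set" where
  "input_laws P = {\<mu>. prob_space \<mu> \<and> sets \<mu> = sets borel \<and>
                      (\<integral>\<^sup>+ x. ennreal ((norm x)\<^sup>2) \<partial>\<mu>) \<le> ennreal P}"

definition channel_joint :: "(real^'n) measure \<Rightarrow> (real^'n) measure \<Rightarrow> ((real^'n) \<times> (real^'n)) measure" where
  "channel_joint \<mu> \<nu> = distr (\<mu> \<Otimes>\<^sub>M \<nu>) (borel \<Otimes>\<^sub>M borel) (\<lambda>(x, z). (x, x + z))"

text \<open>Mutual information (natural log) of a joint law: KL divergence of the joint law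
  from the product of its marginals, exactly as in HOL-Probability's mutual_information.\<close>
definition mutual_info_law :: "((real^'n) \<times> (real^'n)) measure \<Rightarrow> real" where
  "mutual_info_law J =
     KL_divergence (exp 1) (distr J borel fst \<Otimes>\<^sub>M distr J borel snd) J"

definition capacity :: "(real^'n) measure \<Rightarrow> real \<Rightarrow> ereal" where
  "capacity \<nu> P = (SUP \<mu>\<in>input_laws P. ereal (mutual_info_law (channel_joint \<mu> \<nu>)))"

end

theory Submission
  imports Defs
begin

text \<open>
  Let \<open>F\<close> be a bounded noise density with finite second moment and a Gaussian lower bound
  \<open>F n \<ge> A * exp (- B * \<parallel>n\<parallel>\<^sup>2)\<close>, and let \<open>out\<close> be the density of \<open>X + N\<close>.
  Then \<open>I(X; X + N) = E (ln (F N)) - E (ln (out (X + N)))\<close>.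
  For the upper bound, \<open>ln F \<le> ln M\<close>, and replacing \<open>out\<close> by the density of \<open>N(0, P I)\<close> only
  increases the cross entropy, which is then \<open>p / 2 * ln P + O(1)\<close> because
  \<open>E \<parallel>X + N\<parallel>\<^sup>2 \<le> 2 P + O(1)\<close>.
  For the lower bound take \<open>X\<close> uniform on the ball of radius \<open>sqrt P\<close>: then \<open>out\<close> is at most
  the reciprocal volume of that ball, a constant times \<open>P powr (- p / 2)\<close>.

  The NDFHL density is such an \<open>F\<close>: it is the mixture of isotropic Gaussians of variance \<open>exp w\<close>
  with \<open>w\<close> distributed as the logarithm of an inverse Gaussian variable, and on this scale the
  substitution \<open>w = ln (\<rho> / u) + s\<close> turns the mixture integral into the integral defining the
  Bessel function.
\<close>

section \<open>Translation and reflection invariance of Lebesgue measure\<close>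

lemma nn_integral_lborel_translate:
  fixes c :: "'a::euclidean_space"
  assumes [measurable]: "f \<in> borel_measurable borel"
  shows "(\<integral>\<^sup>+y. f (c + y) \<partial>lborel) = (\<integral>\<^sup>+y. f y \<partial>lborel)"
proof -
  have "(\<integral>\<^sup>+y. f y \<partial>lborel) = (\<integral>\<^sup>+y. f y \<partial>distr lborel borel ((+) c))"
    by (simp add: lborel_distr_plus)
  also have "\<dots> = (\<integral>\<^sup>+y. f (c + y) \<partial>lborel)"
    by (subst nn_integral_distr) auto
  finally show ?thesis ..
qed

lemma nn_integral_lborel_reflect:
  fixes c :: "'a::euclidean_space"
  assumes [measurable]: "f \<in> borel_measurable borel"
  shows "(\<integral>\<^sup>+y. f (c - y) \<partial>lborel) = (\<integral>\<^sup>+y. f y \<partial>lborel)"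
proof -
  have eq: "(lborel :: 'a measure) = density (distr lborel borel (\<lambda>y. c - y)) (\<lambda>_. 1)"
    using lborel_affine[of "-1" c] by simp
  have "(\<integral>\<^sup>+y. f y \<partial>lborel) = (\<integral>\<^sup>+y. f y \<partial>density (distr lborel borel (\<lambda>y. c - y)) (\<lambda>_. 1))"
    by (rule arg_cong[OF eq, of "\<lambda>M. \<integral>\<^sup>+y. f y \<partial>M"])
  also have "\<dots> = (\<integral>\<^sup>+y. f (c - y) \<partial>lborel)"
    by (simp add: nn_integral_density nn_integral_distr)
  finally show ?thesis ..
qed

section \<open>Isotropic Gaussian densities\<close>

definition isotropic_gaussian :: "real \<Rightarrow> 'a::euclidean_space \<Rightarrow> real" where
  "isotropic_gaussian t x =
     (2 * pi * t) powr (- real DIM('a) / 2) * exp (- (norm x)\<^sup>2 / (2 * t))"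

lemma isotropic_gaussian_pos: "t > 0 \<Longrightarrow> isotropic_gaussian t x > 0"
  by (simp add: isotropic_gaussian_def)

lemma measurable_isotropic_gaussian [measurable]:
  "isotropic_gaussian t \<in> borel_measurable borel"
  unfolding isotropic_gaussian_def by measurable

text \<open>The squared norm is the sum of the squared coordinates, so the exponential factors over
  the basis. This reduces the total mass to that of one-dimensional normal densities.\<close>

lemma isotropic_gaussian_eq_prod:
  fixes x :: "'a::euclidean_space"
  assumes "t > 0"
  shows "isotropic_gaussian t x = (\<Prod>b\<in>Basis. normal_density 0 (sqrt t) (x \<bullet> b))"
proof -
  have "(\<Prod>b\<in>Basis. normal_density 0 (sqrt t) (x \<bullet> b)) =
        (1 / sqrt (2 * pi * t)) ^ DIM('a) * exp (\<Sum>b\<in>Basis. - (x \<bullet> b)\<^sup>2 / (2 * t))"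
    using assms by (simp add: normal_density_def prod.distrib exp_sum prod_dividef power_divide)
  also have "(\<Sum>b\<in>Basis. - (x \<bullet> b)\<^sup>2 / (2 * t)) = - (norm x)\<^sup>2 / (2 * t)"
    by (simp add: sum_divide_distrib[symmetric] sum_negf euclidean_inner[of x x]
        power2_norm_eq_inner power2_eq_square[of "x \<bullet> _"])
  also have "(1 / sqrt (2 * pi * t)) ^ DIM('a) = (2 * pi * t) powr (- real DIM('a) / 2)"
  proof -
    have "1 / sqrt (2 * pi * t) = (2 * pi * t) powr (- 1 / 2)"
      using assms by (simp add: powr_minus_divide powr_half_sqrt)
    then show ?thesis
      using assms by (simp add: powr_realpow[symmetric] powr_powr)
  qed
  finally show ?thesis by (simp add: isotropic_gaussian_def)
qed

lemma nn_integral_isotropic_gaussian: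
  assumes "t > 0"
  shows "(\<integral>\<^sup>+x. isotropic_gaussian t x \<partial>(lborel :: 'a::euclidean_space measure)) = 1"
proof -
  have "(\<integral>\<^sup>+x. isotropic_gaussian t x \<partial>(lborel :: 'a measure)) =
     (\<integral>\<^sup>+x. (\<Prod>b\<in>Basis. ennreal (normal_density 0 (sqrt t) (x \<bullet> b))) \<partial>(lborel :: 'a measure))"
    using assms by (simp add: isotropic_gaussian_eq_prod prod_ennreal)
  also have "\<dots> = (\<Prod>b\<in>(Basis::'a set). (\<integral>\<^sup>+x. normal_density 0 (sqrt t) x \<partial>lborel))"
    by (rule nn_integral_lborel_prod) auto
  also have "\<dots> = 1"
    using assms by (simp add: nn_integral_eq_integral integrable_normal_density integral_normal_density)
  finally show ?thesis .
qed

text \<open>The gap between the two sides is \<open>(norm (x - z))\<^sup>2\<close>.\<close>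

lemma norm_add_square_le:
  fixes x z :: "'a::real_inner"
  shows "(norm (x + z))\<^sup>2 \<le> 2 * (norm x)\<^sup>2 + 2 * (norm z)\<^sup>2"
proof -
  have "0 \<le> (norm (x - z))\<^sup>2" by simp
  then show ?thesis
    by (simp add: power2_norm_eq_inner inner_add_left inner_add_right inner_diff_left
        inner_diff_right inner_commute)
qed

section \<open>Additive-noise channels: joint law, output density, mutual information\<close>

text \<open>The Gaussian minorant makes \<open>F\<close> strictly positive and lets
  \<open>- ln F\<close> grow at most quadratically, so finite second moments control the logarithms
  that occur; \<open>M\<close> caps \<open>ln F\<close> from above.\<close>

locale noise_density =
  fixes F :: "real^'n \<Rightarrow> real" and M S A B :: real
  assumes F_measurable [measurable]: "F \<in> borel_measurable borel"
    and A_pos: "A > 0" and B_nonneg: "B \<ge> 0" and S_nonneg: "S \<ge> 0"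
    and F_ge: "\<And>n. A * exp (- B * (norm n)\<^sup>2) \<le> F n"
    and F_le: "\<And>n. F n \<le> M"
    and F_integral: "(\<integral>\<^sup>+n. F n \<partial>lborel) = 1"
    and F_second_moment: "(\<integral>\<^sup>+n. (norm n)\<^sup>2 * F n \<partial>lborel) \<le> S"
begin

definition noise :: "(real^'n) measure" where
  "noise = density lborel F"

lemma F_pos: "F n > 0"
  using F_ge[of n] A_pos by (smt (verit) exp_gt_zero mult_pos_pos)

lemma M_pos: "M > 0"
  using F_pos[of 0] F_le[of 0] by linarith

lemma sets_noise [measurable_cong, simp]: "sets noise = sets borel"
  by (simp add: noise_def)

lemma prob_space_noise: "prob_space noise"
  by (rule prob_spaceI) (simp add: noise_def emeasure_density F_integral)

end

locale noisy_channel = noise_density F M S A B + input: prob_space \<mu>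
  for F :: "real^'n \<Rightarrow> real" and M S A B :: real and \<mu> :: "(real^'n) measure" +
  assumes sets_input [measurable_cong, simp]: "sets \<mu> = sets borel"
begin

definition out :: "real^'n \<Rightarrow> real" where
  "out y = (\<integral>x. F (y - x) \<partial>\<mu>)"

abbreviation joint :: "((real^'n) \<times> (real^'n)) measure" where
  "joint \<equiv> channel_joint \<mu> noise"

lemma space_input [simp]: "space \<mu> = UNIV"
  using sets_eq_imp_space_eq[OF sets_input] by simp

lemma integrable_shifted_F: "integrable \<mu> (\<lambda>x. F (y - x))"
  by (rule input.integrable_const_bound[of _ M]) (auto simp: F_le less_imp_le[OF F_pos])

lemma nn_integral_shifted_F: "(\<integral>\<^sup>+x. F (y - x) \<partial>\<mu>) = ennreal (out y)"
  unfolding out_def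
  by (rule nn_integral_eq_integral[OF integrable_shifted_F]) (auto simp: less_imp_le[OF F_pos])

lemma out_measurable [measurable]: "out \<in> borel_measurable borel"
  unfolding out_def by measurable

text \<open>The bound on the square of a sum splits the Gaussian minorant of
  \<open>F (y - x)\<close> into a factor in \<open>y\<close> and a factor in \<open>x\<close>. Hence
  \<open>out\<close> is positive everywhere and \<open>- ln out\<close> grows at most
  quadratically.\<close>

lemma out_ge: "A * exp (- 2 * B * (norm y)\<^sup>2) * (\<integral>x. exp (- 2 * B * (norm x)\<^sup>2) \<partial>\<mu>) \<le> out y"
proof -
  have int: "integrable \<mu> (\<lambda>x. exp (- 2 * B * (norm x)\<^sup>2))"
    by (rule input.integrable_const_bound[of _ 1]) (auto simp: B_nonneg)
  have "A * exp (- 2 * B * (norm y)\<^sup>2) * (\<integral>x. exp (- 2 * B * (norm x)\<^sup>2) \<partial>\<mu>) =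
        (\<integral>x. A * exp (- 2 * B * (norm y)\<^sup>2) * exp (- 2 * B * (norm x)\<^sup>2) \<partial>\<mu>)"
    by simp
  also have "\<dots> \<le> out y"
    unfolding out_def
  proof (rule integral_mono)
    fix x
    have "B * (norm (y - x))\<^sup>2 \<le> B * (2 * (norm y)\<^sup>2 + 2 * (norm x)\<^sup>2)"
      using norm_add_square_le[of y "-x"] B_nonneg by (intro mult_left_mono) auto
    then have "A * exp (- 2 * B * (norm y)\<^sup>2 + - 2 * B * (norm x)\<^sup>2) \<le> A * exp (- B * (norm (y - x))\<^sup>2)"
      using A_pos by (intro mult_left_mono) (auto simp: algebra_simps)
    also have "\<dots> \<le> F (y - x)" by (rule F_ge)
    finally show "A * exp (- 2 * B * (norm y)\<^sup>2) * exp (- 2 * B * (norm x)\<^sup>2) \<le> F (y - x)"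
      by (simp only: exp_add mult.assoc)
  qed (use int integrable_shifted_F in auto)
  finally show ?thesis .
qed

lemma gaussian_average_pos: "(\<integral>x. exp (- 2 * B * (norm x)\<^sup>2) \<partial>\<mu>) > 0"
proof -
  have int: "integrable \<mu> (\<lambda>x. exp (- 2 * B * (norm x)\<^sup>2))"
    by (rule input.integrable_const_bound[of _ 1]) (auto simp: B_nonneg)
  show ?thesis
    using input.expectation_greater[OF int, of 0] by simp
qed

lemma out_pos: "out y > 0"
  by (rule less_le_trans[OF _ out_ge]) (intro mult_pos_pos A_pos gaussian_average_pos exp_gt_zero)

lemma F_nonzero [simp]: "F n \<noteq> 0" and out_nonzero [simp]: "out y \<noteq> 0"
  using F_pos[of n] out_pos[of y] by auto

text \<open>Substituting \<open>y = x + n\<close> shows that \<open>F (y - x)\<close> is the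
  conditional density of the output given the input \<open>x\<close>.\<close>

lemma nn_integral_joint:
  fixes h :: "_ \<Rightarrow> ennreal"
  assumes [measurable]: "h \<in> borel_measurable (borel \<Otimes>\<^sub>M borel)"
  shows "(\<integral>\<^sup>+z. h z \<partial>joint) = (\<integral>\<^sup>+x. \<integral>\<^sup>+y. ennreal (F (y - x)) * h (x, y) \<partial>lborel \<partial>\<mu>)"
proof -
  interpret N: prob_space noise by (rule prob_space_noise)
  have "(\<integral>\<^sup>+z. h z \<partial>joint) = (\<integral>\<^sup>+x. \<integral>\<^sup>+n. h (x, x + n) \<partial>noise \<partial>\<mu>)"
    unfolding channel_joint_def
    by (subst nn_integral_distr) (auto simp: N.nn_integral_fst[symmetric] split_beta)
  also have "\<dots> = (\<integral>\<^sup>+x. \<integral>\<^sup>+n. ennreal (F ((x + n) - x)) * h (x, x + n) \<partial>lborel \<partial>\<mu>)"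
    by (simp add: noise_def nn_integral_density)
  also have "\<dots> = (\<integral>\<^sup>+x. \<integral>\<^sup>+y. ennreal (F (y - x)) * h (x, y) \<partial>lborel \<partial>\<mu>)"
    by (intro nn_integral_cong nn_integral_lborel_translate) auto
  finally show ?thesis .
qed

lemma sets_joint [measurable_cong, simp]: "sets joint = sets (borel \<Otimes>\<^sub>M borel)"
  by (simp add: channel_joint_def)

lemma nn_integral_noise_shift: "(\<integral>\<^sup>+y. F (y - x) \<partial>lborel) = 1"
  using nn_integral_lborel_translate[of "\<lambda>y. ennreal (F y)" "-x"] F_integral by simp

lemma nn_integral_joint_fst:
  fixes h :: "_ \<Rightarrow> ennreal"
  assumes [measurable]: "h \<in> borel_measurable borel"
  shows "(\<integral>\<^sup>+z. h (fst z) \<partial>joint) = (\<integral>\<^sup>+x. h x \<partial>\<mu>)"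
  by (subst nn_integral_joint) (auto simp: nn_integral_multc nn_integral_noise_shift)

lemma nn_integral_joint_snd:
  fixes h :: "_ \<Rightarrow> ennreal"
  assumes [measurable]: "h \<in> borel_measurable borel"
  shows "(\<integral>\<^sup>+z. h (snd z) \<partial>joint) = (\<integral>\<^sup>+y. ennreal (out y) * h y \<partial>lborel)"
proof -
  interpret pair_sigma_finite \<mu> "lborel :: (real^'n) measure" ..
  have "(\<integral>\<^sup>+z. h (snd z) \<partial>joint) = (\<integral>\<^sup>+x. \<integral>\<^sup>+y. ennreal (F (y - x)) * h y \<partial>lborel \<partial>\<mu>)"
    by (subst nn_integral_joint) auto
  also have "\<dots> = (\<integral>\<^sup>+y. \<integral>\<^sup>+x. ennreal (F (y - x)) * h y \<partial>\<mu> \<partial>lborel)"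
    by (rule Fubini'[symmetric]) auto
  also have "\<dots> = (\<integral>\<^sup>+y. ennreal (out y) * h y \<partial>lborel)"
    by (simp add: nn_integral_multc nn_integral_shifted_F)
  finally show ?thesis .
qed

lemma distr_joint_fst: "distr joint borel fst = \<mu>"
proof (rule measure_eqI)
  fix X assume "X \<in> sets (distr joint borel fst)"
  then have X[measurable]: "X \<in> sets borel" by simp
  have "emeasure (distr joint borel fst) X = (\<integral>\<^sup>+x. indicator X x \<partial>distr joint borel fst)"
    by simp
  also have "\<dots> = (\<integral>\<^sup>+z. indicator X (fst z) \<partial>joint)"
    by (rule nn_integral_distr) auto
  also have "\<dots> = emeasure \<mu> X"
    by (subst nn_integral_joint_fst) auto
  finally show "emeasure (distr joint borel fst) X = emeasure \<mu> X" .
qed simp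

lemma distr_joint_snd: "distr joint borel snd = density lborel out"
proof (rule measure_eqI)
  fix X assume "X \<in> sets (distr joint borel snd)"
  then have X[measurable]: "X \<in> sets borel" by simp
  have "emeasure (distr joint borel snd) X = (\<integral>\<^sup>+x. indicator X x \<partial>distr joint borel snd)"
    by simp
  also have "\<dots> = (\<integral>\<^sup>+z. indicator X (snd z) \<partial>joint)"
    by (rule nn_integral_distr) auto
  also have "\<dots> = emeasure (density lborel out) X"
    by (subst nn_integral_joint_snd) (auto simp: emeasure_density)
  finally show "emeasure (distr joint borel snd) X = emeasure (density lborel out) X" .
qed simp

lemma prob_space_joint: "prob_space joint"
proof -
  interpret N: prob_space noise by (rule prob_space_noise)
  interpret pair_prob_space \<mu> noise ..
  show ?thesis
    unfolding channel_joint_def by (rule prob_space_distr) auto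
qed

lemma prob_space_out: "prob_space (density lborel out)"
proof -
  interpret J: prob_space joint by (rule prob_space_joint)
  show ?thesis
    using J.prob_space_distr[of snd borel] by (simp add: distr_joint_snd)
qed

text \<open>The likelihood ratio of the joint law against the product of its marginals is the
  conditional output density over the unconditional one; positivity of \<open>out\<close> makes the
  quotient harmless.\<close>

lemma joint_eq_density:
  "joint = density (\<mu> \<Otimes>\<^sub>M density lborel out) (\<lambda>z. F (snd z - fst z) / out (snd z))"
proof (rule measure_eqI)
  interpret Y: prob_space "density lborel out" by (rule prob_space_out)
  fix X assume "X \<in> sets joint"
  then have X[measurable]: "X \<in> sets (borel \<Otimes>\<^sub>M borel)" by simp
  have "emeasure joint X = (\<integral>\<^sup>+z. indicator X z \<partial>joint)"
    by simp
  also have "\<dots> = (\<integral>\<^sup>+x. \<integral>\<^sup>+y. ennreal (F (y - x)) * indicator X (x, y) \<partial>lborel \<partial>\<mu>)"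
    by (rule nn_integral_joint) auto
  also have "\<dots> = (\<integral>\<^sup>+x. \<integral>\<^sup>+y. ennreal (out y) * (ennreal (F (y - x) / out y) * indicator X (x, y)) \<partial>lborel \<partial>\<mu>)"
    using out_pos F_pos
    by (intro nn_integral_cong)
       (simp add: mult.assoc[symmetric] ennreal_mult''[symmetric] less_imp_le less_imp_neq[THEN not_sym])
  also have "\<dots> = (\<integral>\<^sup>+x. \<integral>\<^sup>+y. ennreal (F (y - x) / out y) * indicator X (x, y) \<partial>density lborel out \<partial>\<mu>)"
    by (subst nn_integral_density) auto
  also have "\<dots> = emeasure (density (\<mu> \<Otimes>\<^sub>M density lborel out) (\<lambda>z. F (snd z - fst z) / out (snd z))) X"
    by (auto simp: emeasure_density Y.nn_integral_fst[symmetric])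
  finally show "emeasure joint X = emeasure (density (\<mu> \<Otimes>\<^sub>M density lborel out) (\<lambda>z. F (snd z - fst z) / out (snd z))) X" .
qed (auto cong: sets_pair_measure_cong)

text \<open>The KL divergence of a measure given by a density is the integral of
  \<open>r * ln r\<close> for the likelihood ratio \<open>r\<close>, and the factor \<open>r\<close>
  turns the product measure back into the joint law. Without integrability both sides take the
  default value 0 of the Bochner integral.\<close>

lemma mutual_info_eq:
  "mutual_info_law joint = (\<integral>z. ln (F (snd z - fst z) / out (snd z)) \<partial>joint)"
proof -
  let ?r = "\<lambda>z. F (snd z - fst z) / out (snd z)"
  let ?M = "\<mu> \<Otimes>\<^sub>M density lborel out"
  interpret Y: prob_space "density lborel out" by (rule prob_space_out)
  interpret P: pair_prob_space \<mu> "density lborel out" ..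
  have r: "?r \<in> borel_measurable ?M" and r0: "?r z \<ge> 0" for z
    using out_pos F_pos by (auto simp: less_imp_le)
  have "mutual_info_law joint = KL_divergence (exp 1) ?M joint"
    by (simp add: mutual_info_law_def distr_joint_fst distr_joint_snd)
  also have "\<dots> = KL_divergence (exp 1) ?M (density ?M ?r)"
    by (subst (1) joint_eq_density) simp
  also have "\<dots> = (\<integral>z. ?r z * log (exp 1) (?r z) \<partial>?M)"
    by (rule P.P.KL_density) (use r r0 in auto)
  also have "\<dots> = (\<integral>z. ln (?r z) \<partial>density ?M ?r)"
    using r0 by (subst integral_real_density) (auto simp: log_def)
  also have "\<dots> = (\<integral>z. ln (?r z) \<partial>joint)"
    by (simp flip: joint_eq_density)
  finally show ?thesis .
qed

text \<open>Output minus input is the noise, whose law is the same for every value of the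
  input.\<close>

lemma nn_integral_joint_diff:
  fixes h :: "_ \<Rightarrow> ennreal"
  assumes [measurable]: "h \<in> borel_measurable borel"
  shows "(\<integral>\<^sup>+z. h (snd z - fst z) \<partial>joint) = (\<integral>\<^sup>+n. ennreal (F n) * h n \<partial>lborel)"
proof -
  have "(\<integral>\<^sup>+z. h (snd z - fst z) \<partial>joint) =
        (\<integral>\<^sup>+x. \<integral>\<^sup>+y. ennreal (F (- x + y)) * h (- x + y) \<partial>lborel \<partial>\<mu>)"
    by (subst nn_integral_joint) auto
  also have "\<dots> = (\<integral>\<^sup>+x. \<integral>\<^sup>+n. ennreal (F n) * h n \<partial>lborel \<partial>\<mu>)"
    by (intro nn_integral_cong nn_integral_lborel_translate) auto
  also have "\<dots> = (\<integral>\<^sup>+n. ennreal (F n) * h n \<partial>lborel)"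
    by (simp add: input.emeasure_space_1[simplified])
  finally show ?thesis .
qed

lemma nn_integral_joint_diff_square:
  "(\<integral>\<^sup>+z. (norm (snd z - fst z))\<^sup>2 \<partial>joint) \<le> ennreal S"
proof -
  have "(\<integral>\<^sup>+z. ennreal ((norm (snd z - fst z))\<^sup>2) \<partial>joint) =
        (\<integral>\<^sup>+n. ennreal (F n) * ennreal ((norm n)\<^sup>2) \<partial>lborel)"
    by (rule nn_integral_joint_diff) auto
  also have "\<dots> = (\<integral>\<^sup>+n. (norm n)\<^sup>2 * F n \<partial>lborel)"
    using F_pos by (intro nn_integral_cong) (auto simp: ennreal_mult less_imp_le mult.commute)
  finally show ?thesis using F_second_moment by simp
qed

lemma noise_energy:
  shows "integrable joint (\<lambda>z. (norm (snd z - fst z))\<^sup>2)"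
    and "(\<integral>z. (norm (snd z - fst z))\<^sup>2 \<partial>joint) \<le> S"
proof -
  show *: "integrable joint (\<lambda>z. (norm (snd z - fst z))\<^sup>2)"
    using nn_integral_joint_diff_square
    by (intro integrableI_nonneg) (auto simp: le_less_trans)
  have "ennreal (\<integral>z. (norm (snd z - fst z))\<^sup>2 \<partial>joint) \<le> ennreal S"
    using nn_integral_joint_diff_square by (subst nn_integral_eq_integral[OF *, symmetric]) auto
  then show "(\<integral>z. (norm (snd z - fst z))\<^sup>2 \<partial>joint) \<le> S"
    using S_nonneg by simp
qed

end

section \<open>Mutual information under a power constraint\<close>

locale power_constrained_channel = noisy_channel F M S A B \<mu>
  for F :: "real^'n \<Rightarrow> real" and M S A B :: real and \<mu> :: "(real^'n) measure" +
  fixes P :: real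
  assumes P_nonneg: "P \<ge> 0"
    and input_power: "(\<integral>\<^sup>+x. (norm x)\<^sup>2 \<partial>\<mu>) \<le> ennreal P"
begin

text \<open>The crude factor 2 is affordable: the energy will be divided by \<open>2 * P\<close>,
  which leaves a bounded quantity.\<close>

lemma output_energy:
  shows "integrable joint (\<lambda>z. (norm (snd z))\<^sup>2)"
    and "(\<integral>z. (norm (snd z))\<^sup>2 \<partial>joint) \<le> 2 * P + 2 * S"
proof -
  have "(\<integral>\<^sup>+z. (norm (snd z))\<^sup>2 \<partial>joint) \<le>
        (\<integral>\<^sup>+z. 2 * ennreal ((norm (fst z))\<^sup>2) + 2 * ennreal ((norm (snd z - fst z))\<^sup>2) \<partial>joint)"
  proof (rule nn_integral_mono)
    fix z :: "(real^'n) \<times> (real^'n)"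
    have "(norm (snd z))\<^sup>2 \<le> 2 * (norm (fst z))\<^sup>2 + 2 * (norm (snd z - fst z))\<^sup>2"
      using norm_add_square_le[of "fst z" "snd z - fst z"] by simp
    then have "ennreal ((norm (snd z))\<^sup>2) \<le> ennreal (2 * (norm (fst z))\<^sup>2 + 2 * (norm (snd z - fst z))\<^sup>2)"
      by (rule ennreal_leI)
    then show "ennreal ((norm (snd z))\<^sup>2) \<le> 2 * ennreal ((norm (fst z))\<^sup>2) + 2 * ennreal ((norm (snd z - fst z))\<^sup>2)"
      by (simp add: ennreal_mult'')
  qed
  also have "\<dots> = 2 * (\<integral>\<^sup>+z. (norm (fst z))\<^sup>2 \<partial>joint) + 2 * (\<integral>\<^sup>+z. (norm (snd z - fst z))\<^sup>2 \<partial>joint)"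
    by (simp add: nn_integral_add nn_integral_cmult)
  also have "(\<integral>\<^sup>+z. (norm (fst z))\<^sup>2 \<partial>joint) = (\<integral>\<^sup>+x. (norm x)\<^sup>2 \<partial>\<mu>)"
    by (rule nn_integral_joint_fst) auto
  also have "2 * \<dots> + 2 * (\<integral>\<^sup>+z. (norm (snd z - fst z))\<^sup>2 \<partial>joint) \<le> 2 * ennreal P + 2 * ennreal S"
    by (intro add_mono mult_left_mono input_power nn_integral_joint_diff_square) auto
  also have "\<dots> = ennreal (2 * P + 2 * S)"
    using P_nonneg S_nonneg by (simp add: ennreal_mult'')
  finally have le: "(\<integral>\<^sup>+z. (norm (snd z))\<^sup>2 \<partial>joint) \<le> ennreal (2 * P + 2 * S)" .
  then show *: "integrable joint (\<lambda>z. (norm (snd z))\<^sup>2)"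
    by (intro integrableI_nonneg) (auto simp: le_less_trans)
  have "ennreal (\<integral>z. (norm (snd z))\<^sup>2 \<partial>joint) \<le> ennreal (2 * P + 2 * S)"
    using le by (subst nn_integral_eq_integral[OF *, symmetric]) auto
  then show "(\<integral>z. (norm (snd z))\<^sup>2 \<partial>joint) \<le> 2 * P + 2 * S"
    using P_nonneg S_nonneg by (subst (asm) ennreal_le_iff) auto
qed

text \<open>The output marginal has density \<open>out\<close>, which cancels the denominator and
  leaves the total mass of the Gaussian.\<close>

lemma relative_output_density:
  assumes P: "P > 0"
  shows "integrable joint (\<lambda>z. isotropic_gaussian P (snd z) / out (snd z))"
    and "(\<integral>z. isotropic_gaussian P (snd z) / out (snd z) \<partial>joint) = 1"
proof -
  let ?q = "isotropic_gaussian P :: real^'n \<Rightarrow> real"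
  have "(\<integral>\<^sup>+z. ?q (snd z) / out (snd z) \<partial>joint) = (\<integral>\<^sup>+y. ennreal (out y) * ennreal (?q y / out y) \<partial>lborel)"
    by (rule nn_integral_joint_snd) auto
  also have "\<dots> = (\<integral>\<^sup>+y. ?q y \<partial>lborel)"
    using out_pos by (intro nn_integral_cong) (simp add: ennreal_mult'[symmetric] less_imp_le)
  also have "\<dots> = 1"
    by (rule nn_integral_isotropic_gaussian[OF P])
  finally have *: "(\<integral>\<^sup>+z. ?q (snd z) / out (snd z) \<partial>joint) = 1" .
  have nn: "?q (snd z) / out (snd z) \<ge> 0" for z :: "(real^'n) \<times> (real^'n)"
    by (intro divide_nonneg_pos out_pos less_imp_le[OF isotropic_gaussian_pos[OF P]])
  show "integrable joint (\<lambda>z. ?q (snd z) / out (snd z))"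
    using * nn by (intro integrableI_nonneg) auto
  show "(\<integral>z. ?q (snd z) / out (snd z) \<partial>joint) = 1"
    using * nn by (subst integral_eq_nn_integral) auto
qed

lemma mutual_info_le:
  assumes P: "P \<ge> 1"
  shows "mutual_info_law joint \<le> CARD('n) / 2 * ln P + (\<bar>ln M\<bar> + CARD('n) / 2 * ln (2 * pi) + 1 + S)"
    (is "_ \<le> ?R")
proof (cases "integrable joint (\<lambda>z. ln (F (snd z - fst z) / out (snd z)))")
  case False
  \<comment> \<open>A non-integrable integrand gives mutual information 0 by default, so the bound
    only has to be nonnegative; this is where \<open>\<bar>ln M\<bar>\<close> in place of
    \<open>ln M\<close>, and \<open>P \<ge> 1\<close>, enter.\<close>
  have "ln P \<ge> 0" using P by simp
  moreover have "ln (2 * pi) \<ge> 0" using pi_gt3 by (intro ln_ge_zero) auto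
  ultimately have "?R \<ge> 0"
    using S_nonneg by (intro add_nonneg_nonneg mult_nonneg_nonneg) auto
  then show ?thesis
    using False by (simp add: mutual_info_eq not_integrable_integral_eq)
next
  case True
  interpret J: prob_space joint by (rule prob_space_joint)
  let ?q = "isotropic_gaussian P :: real^'n \<Rightarrow> real"
  have P0: "P > 0" using P by simp
  \<comment> \<open>Collects the constants of \<open>ln M - ln q\<close>. The \<open>- 1\<close>
    comes from \<open>ln r \<le> r - 1\<close> and later cancels against the mean 1 of
    \<open>?q / out\<close>.\<close>
  define c where "c = ln M + CARD('n) / 2 * ln (2 * pi * P) - 1"
  \<comment> \<open>Replacing the output density by the Gaussian q costs \<open>ln (q / out) \<le> q / out - 1\<close>, of mean 0.\<close>
  have pointwise: "ln (F (snd z - fst z) / out (snd z)) \<le>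
      ?q (snd z) / out (snd z) + (c + (norm (snd z))\<^sup>2 / (2 * P))" for z
  proof -
    have q: "?q (snd z) > 0" by (rule isotropic_gaussian_pos[OF P0])
    have "ln (?q (snd z) / out (snd z)) \<le> ?q (snd z) / out (snd z) - 1"
      using q out_pos by (intro ln_le_minus_one) auto
    moreover have "ln (?q (snd z) / out (snd z)) = ln (?q (snd z)) - ln (out (snd z))"
      using q out_pos by (simp add: ln_div)
    moreover have "ln (?q (snd z)) = - CARD('n) / 2 * ln (2 * pi * P) - (norm (snd z))\<^sup>2 / (2 * P)"
      using P0 by (simp add: isotropic_gaussian_def ln_mult ln_powr)
    moreover have "ln (F (snd z - fst z) / out (snd z)) = ln (F (snd z - fst z)) - ln (out (snd z))"
      using F_pos out_pos by (simp add: ln_div)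
    moreover have "ln (F (snd z - fst z)) \<le> ln M"
      using F_pos F_le M_pos by simp
    ultimately show ?thesis by (simp add: c_def)
  qed
  note [simp] = relative_output_density[OF P0] output_energy(1)
  have "mutual_info_law joint \<le>
     (\<integral>z. ?q (snd z) / out (snd z) + (c + (norm (snd z))\<^sup>2 / (2 * P)) \<partial>joint)"
    unfolding mutual_info_eq by (rule integral_mono[OF True]) (auto simp: pointwise)
  also have "\<dots> = 1 + (c + (\<integral>z. (norm (snd z))\<^sup>2 \<partial>joint) / (2 * P))"
    by (simp add: J.prob_space)
  also have "\<dots> \<le> 1 + (c + (2 * P + 2 * S) / (2 * P))"
    using P0 output_energy(2) by (intro add_left_mono divide_right_mono) auto
  also have "(2 * P + 2 * S) / (2 * P) = 1 + S / P"
    using P0 by (simp add: field_simps)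
  also have "1 + (c + (1 + S / P)) \<le> ?R"
  proof -
    have "S / P \<le> S" using P S_nonneg using mult_left_mono[of 1 P S] by (simp add: divide_le_eq)
    moreover have "ln (2 * pi * P) = ln (2 * pi) + ln P" using P0 by (simp add: ln_mult)
    ultimately show ?thesis by (simp add: c_def algebra_simps)
  qed
  finally show ?thesis .
qed

text \<open>A uniform bound on \<open>out\<close> gives \<open>- ln out \<ge> - ln c\<close>, and
  the Gaussian minorant gives the mean of \<open>ln F\<close> the lower bound
  \<open>ln A - B * S\<close>.\<close>

lemma mutual_info_ge:
  assumes c: "c > 0" "\<And>y. out y \<le> c"
  shows "ln A - B * S - ln c \<le> mutual_info_law joint"
proof -
  interpret J: prob_space joint by (rule prob_space_joint)
  define a where "a = ln A + ln (\<integral>x. exp (- 2 * B * (norm x)\<^sup>2) \<partial>\<mu>)"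
  let ?l = "\<lambda>z :: (real^'n) \<times> (real^'n). ln (F (snd z - fst z) / out (snd z))"
  have eq: "?l z = ln (F (snd z - fst z)) - ln (out (snd z))" for z :: "(real^'n) \<times> (real^'n)"
    using F_pos out_pos by (simp add: ln_div)
  have lower: "?l z \<ge> ln A - B * (norm (snd z - fst z))\<^sup>2 - ln c" for z :: "(real^'n) \<times> (real^'n)"
  proof -
    have "ln (A * exp (- B * (norm (snd z - fst z))\<^sup>2)) \<le> ln (F (snd z - fst z))"
      using A_pos F_pos F_ge by (subst ln_le_cancel_iff) auto
    moreover have "ln (out (snd z)) \<le> ln c"
      using c out_pos by simp
    ultimately show ?thesis using A_pos unfolding eq by (simp add: ln_mult)
  qed
  \<comment> \<open>Serves only integrability: otherwise the integral would default to 0 and the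
    pointwise lower bound would say nothing about it. The constant \<open>a\<close> may therefore
    depend on the input law.\<close>
  have upper: "?l z \<le> ln M - a + 2 * B * (norm (snd z))\<^sup>2" for z :: "(real^'n) \<times> (real^'n)"
  proof -
    have "ln (A * exp (- 2 * B * (norm (snd z))\<^sup>2) * (\<integral>x. exp (- 2 * B * (norm x)\<^sup>2) \<partial>\<mu>)) \<le> ln (out (snd z))"
      using A_pos out_pos gaussian_average_pos out_ge by (subst ln_le_cancel_iff) auto
    moreover have "ln (F (snd z - fst z)) \<le> ln M"
      using F_pos F_le M_pos by simp
    ultimately show ?thesis
      using A_pos gaussian_average_pos unfolding eq by (simp add: ln_mult a_def)
  qed
  note [simp] = noise_energy(1) output_energy(1)
  have int: "integrable joint ?l"
  proof (rule Bochner_Integration.integrable_bound)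
    show "integrable joint (\<lambda>z. (\<bar>ln A\<bar> + \<bar>ln c\<bar> + \<bar>ln M\<bar> + \<bar>a\<bar>) + B * (norm (snd z - fst z))\<^sup>2
        + 2 * B * (norm (snd z))\<^sup>2)"
      by auto
    show "AE z in joint. norm (?l z) \<le> norm ((\<bar>ln A\<bar> + \<bar>ln c\<bar> + \<bar>ln M\<bar> + \<bar>a\<bar>) + B * (norm (snd z - fst z))\<^sup>2
        + 2 * B * (norm (snd z))\<^sup>2)"
    proof (rule AE_I2)
      fix z :: "(real^'n) \<times> (real^'n)"
      have "B * (norm (snd z - fst z))\<^sup>2 \<ge> 0" "2 * B * (norm (snd z))\<^sup>2 \<ge> 0"
        using B_nonneg by auto
      then show "norm (?l z) \<le> norm ((\<bar>ln A\<bar> + \<bar>ln c\<bar> + \<bar>ln M\<bar> + \<bar>a\<bar>) + B * (norm (snd z - fst z))\<^sup>2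
        + 2 * B * (norm (snd z))\<^sup>2)"
        using lower[of z] upper[of z] unfolding real_norm_def by linarith
    qed
  qed auto
  have "ln A - B * S - ln c \<le> ln A - B * (\<integral>z. (norm (snd z - fst z))\<^sup>2 \<partial>joint) - ln c"
    using noise_energy(2) B_nonneg by (simp add: mult_left_mono)
  also have "\<dots> = (\<integral>z. ln A - B * (norm (snd z - fst z))\<^sup>2 - ln c \<partial>joint)"
    by (simp add: J.prob_space)
  also have "\<dots> \<le> mutual_info_law joint"
    unfolding mutual_info_eq by (rule integral_mono[OF _ int]) (use lower in auto)
  finally show ?thesis .
qed

end

section \<open>Capacity bounds for general noise\<close>

context noise_density
begin

lemma power_constrained_channelI:
  assumes "\<mu> \<in> input_laws P" "P \<ge> 0"
  shows "power_constrained_channel F M S A B \<mu> P"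
proof -
  interpret prob_space \<mu> using assms by (simp add: input_laws_def)
  show ?thesis
    using assms by unfold_locales (auto simp: input_laws_def)
qed

text \<open>The radius \<open>sqrt P\<close> enforces the power constraint. The output density at
  \<open>y\<close> is the integral of \<open>F\<close> over a reflected and translated ball divided
  by its volume \<open>v\<close>, and that integral is at most the total mass 1.\<close>

lemma uniform_ball_input:
  assumes P: "P > 0"
  defines "\<mu> \<equiv> uniform_measure lborel (ball (0 :: real^'n) (sqrt P))"
  defines "v \<equiv> unit_ball_vol (CARD('n)) * sqrt P ^ CARD('n)"
  shows "\<mu> \<in> input_laws P" and "noisy_channel.out F \<mu> y \<le> 1 / v"
proof -
  let ?D = "ball (0 :: real^'n) (sqrt P)"
  have v: "v > 0" using P by (simp add: v_def)
  have D: "emeasure lborel ?D = ennreal v"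
    using P by (simp add: emeasure_ball v_def)
  have prob: "prob_space \<mu>"
    unfolding \<mu>_def using v D by (intro prob_space_uniform_measure) auto
  then interpret X: prob_space \<mu> .
  have sets[simp]: "sets \<mu> = sets borel" by (simp add: \<mu>_def)
  have "(\<integral>\<^sup>+x. (norm x)\<^sup>2 \<partial>\<mu>) \<le> (\<integral>\<^sup>+x. P \<partial>\<mu>)"
  proof (rule nn_integral_mono_AE)
    have "AE x in \<mu>. x \<in> ?D"
      unfolding \<mu>_def by (rule AE_uniform_measureI) auto
    then show "AE x in \<mu>. ennreal ((norm x)\<^sup>2) \<le> ennreal P"
    proof eventually_elim
      fix x assume "x \<in> ?D"
      then have "(norm x)\<^sup>2 \<le> (sqrt P)\<^sup>2" by (intro power_mono) auto
      then show "ennreal ((norm x)\<^sup>2) \<le> ennreal P" using P by (simp add: ennreal_leI)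
    qed
  qed
  also have "\<dots> = P" by (simp add: X.emeasure_space_1)
  finally show inp: "\<mu> \<in> input_laws P"
    using prob by (simp add: input_laws_def)
  interpret C: noisy_channel F M S A B \<mu> by unfold_locales simp
  have "ennreal (C.out y) = (\<integral>\<^sup>+x. F (y - x) \<partial>\<mu>)"
    by (rule C.nn_integral_shifted_F[symmetric])
  also have "\<dots> = (\<integral>\<^sup>+x. ennreal (F (y - x)) * indicator ?D x \<partial>lborel) / emeasure lborel ?D"
    unfolding \<mu>_def by (rule nn_integral_uniform_measure) auto
  also have "\<dots> \<le> (\<integral>\<^sup>+x. ennreal (F (y - x)) \<partial>lborel) / emeasure lborel ?D"
    by (intro divide_right_mono_ennreal nn_integral_mono) (auto simp: indicator_def)
  also have "(\<integral>\<^sup>+x. ennreal (F (y - x)) \<partial>lborel) = 1"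
    using nn_integral_lborel_reflect[of "\<lambda>x. ennreal (F x)" y] F_integral by simp
  also have "1 / emeasure lborel ?D = ennreal (1 / v)"
    using v unfolding D by (metis divide_ennreal ennreal_1 zero_le_one)
  finally show "C.out y \<le> 1 / v"
    using v by simp
qed

theorem capacity_bounds:
  assumes P: "P \<ge> 1"
  shows "capacity noise P \<le> ereal (CARD('n) / 2 * ln P + (\<bar>ln M\<bar> + CARD('n) / 2 * ln (2 * pi) + 1 + S))"
    and "ereal (CARD('n) / 2 * ln P + (ln A - B * S + ln (unit_ball_vol (CARD('n))))) \<le> capacity noise P"
proof -
  show "capacity noise P \<le> ereal (CARD('n) / 2 * ln P + (\<bar>ln M\<bar> + CARD('n) / 2 * ln (2 * pi) + 1 + S))"
    unfolding capacity_def
  proof (rule SUP_least)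
    fix \<mu> :: "(real^'n) measure"
    assume "\<mu> \<in> input_laws P"
    then interpret power_constrained_channel F M S A B \<mu> P
      using P by (intro power_constrained_channelI) auto
    show "ereal (mutual_info_law (channel_joint \<mu> noise)) \<le>
        ereal (CARD('n) / 2 * ln P + (\<bar>ln M\<bar> + CARD('n) / 2 * ln (2 * pi) + 1 + S))"
      using mutual_info_le[OF P] by simp
  qed
next
  let ?\<mu> = "uniform_measure lborel (ball (0 :: real^'n) (sqrt P))"
  let ?v = "unit_ball_vol (CARD('n)) * sqrt P ^ CARD('n)"
  have P0: "P > 0" using P by simp
  have "unit_ball_vol (CARD('n)) > 0" by simp
  note [simp] = less_imp_neq[OF this, THEN not_sym]
  from P0 interpret power_constrained_channel F M S A B ?\<mu> P
    by (intro power_constrained_channelI uniform_ball_input) auto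
  have "ln A - B * S - ln (1 / ?v) \<le> mutual_info_law joint"
    using P0 uniform_ball_input(2)[OF P0] by (intro mutual_info_ge) auto
  \<comment> \<open>The factor \<open>sqrt P ^ CARD('n)\<close> of the ball volume supplies exactly
    the leading term of the upper bound.\<close>
  moreover have "ln (1 / ?v) = - (ln (unit_ball_vol (CARD('n))) + CARD('n) / 2 * ln P)"
    using P0 by (simp add: ln_div ln_mult ln_realpow ln_sqrt)
  ultimately have "ereal (CARD('n) / 2 * ln P + (ln A - B * S + ln (unit_ball_vol (CARD('n)))))
      \<le> ereal (mutual_info_law joint)"
    by simp
  also have "\<dots> \<le> capacity noise P"
    unfolding capacity_def by (intro SUP_upper uniform_ball_input P0)
  finally show "ereal (CARD('n) / 2 * ln P + (ln A - B * S + ln (unit_ball_vol (CARD('n))))) \<le> capacity noise P" .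
qed

text \<open>Finiteness accompanies the asymptotics because \<open>real_of_ereal\<close> sends
  infinite values to 0.\<close>

theorem capacity_asymptotics:
  shows "eventually (\<lambda>P. capacity noise P < \<infinity>) at_top"
    and "(\<lambda>P. real_of_ereal (capacity noise P) - CARD('n) / 2 * ln P) \<in> O[at_top](\<lambda>_. 1)"
proof -
  define U where "U = \<bar>ln M\<bar> + CARD('n) / 2 * ln (2 * pi) + 1 + S"
  define L where "L = ln A - B * S + ln (unit_ball_vol (CARD('n)))"
  have bounds: "ereal (CARD('n) / 2 * ln P + L) \<le> capacity noise P"
      "capacity noise P \<le> ereal (CARD('n) / 2 * ln P + U)" if "P \<ge> 1" for P
    using capacity_bounds[OF that] by (simp_all add: U_def L_def)
  show "eventually (\<lambda>P. capacity noise P < \<infinity>) at_top"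
    using eventually_ge_at_top[of 1]
  proof eventually_elim
    case (elim P)
    show ?case using le_less_trans[OF bounds(2)[OF elim], of \<infinity>] by simp
  qed
  show "(\<lambda>P. real_of_ereal (capacity noise P) - CARD('n) / 2 * ln P) \<in> O[at_top](\<lambda>_. 1)"
  proof (rule bigoI[of _ "\<bar>L\<bar> + \<bar>U\<bar>"])
    show "eventually (\<lambda>P. norm (real_of_ereal (capacity noise P) - CARD('n) / 2 * ln P)
        \<le> (\<bar>L\<bar> + \<bar>U\<bar>) * norm (1 :: real)) at_top"
      using eventually_ge_at_top[of 1]
    proof eventually_elim
      case (elim P)
      show ?case
        using bounds[OF elim] by (cases "capacity noise P") auto
    qed
  qed
qed

end

section \<open>The inverse Gaussian law on the logarithmic scale\<close>

text \<open>The density of \<open>ln T\<close> for \<open>T\<close> inverse Gaussian with mean \<open>b / a\<close> and shape \<open>b\<^sup>2\<close>.\<close>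

definition log_inv_gaussian :: "real \<Rightarrow> real \<Rightarrow> real \<Rightarrow> real" where
  "log_inv_gaussian a b w =
     b / sqrt (2 * pi) * exp (- w / 2) * exp (- (a * exp (w / 2) - b * exp (- w / 2))\<^sup>2 / 2)"

lemma measurable_log_inv_gaussian [measurable]:
  "log_inv_gaussian a b \<in> borel_measurable borel"
  unfolding log_inv_gaussian_def by measurable

lemma log_inv_gaussian_nonneg: "b \<ge> 0 \<Longrightarrow> log_inv_gaussian a b w \<ge> 0"
  by (simp add: log_inv_gaussian_def)

text \<open>The inner function is an increasing bijection of the real line and the first factor is
  its derivative, so a change of variables yields the total mass of the standard normal law.\<close>

lemma nn_integral_std_normal_substitution:
  fixes a b :: real
  assumes a: "a > 0" and b: "b > 0"
  shows "(\<integral>\<^sup>+w. (a * exp (w / 2) + b * exp (- w / 2)) / 2 *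
           std_normal_density (a * exp (w / 2) - b * exp (- w / 2)) \<partial>lborel) = 1"
proof -
  define g where "g w = a * exp (w / 2) - b * exp (- w / 2)" for w
  define g' where "g' w = (a * exp (w / 2) + b * exp (- w / 2)) / 2" for w
  have g'_pos: "g' w > 0" for w
    using a b by (simp add: g'_def add_pos_pos)
  have deriv: "(g has_field_derivative g' w) (at w)" for w
    unfolding g_def g'_def by (auto intro!: derivative_eq_intros simp: field_simps)
  have "strict_mono g"
    unfolding strict_mono_def using deriv g'_pos by (blast intro: DERIV_pos_imp_increasing)
  then have inj: "inj g" by (rule strict_mono_imp_inj_on)
  have "y \<in> range g" for y
  proof -
    \<comment> \<open>The positive root of \<open>a * s\<^sup>2 - y * s - b = 0\<close>; the
      preimage of \<open>y\<close> is then \<open>2 * ln s\<close>.\<close>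
    define s where "s = (y + sqrt (y\<^sup>2 + 4 * a * b)) / (2 * a)"
    have "\<bar>y\<bar> < sqrt (y\<^sup>2 + 4 * a * b)"
      using a b by (intro real_less_rsqrt) auto
    then have s: "s > 0" using a by (simp add: s_def)
    have "(2 * a * s - y)\<^sup>2 = y\<^sup>2 + 4 * a * b"
      using a b by (simp add: s_def)
    then have "4 * a * (a * s\<^sup>2 - b) = 4 * a * (y * s)"
      by (simp add: power2_eq_square algebra_simps)
    then have "a * s\<^sup>2 - b = y * s"
      using a by simp
    then have "a * s - b / s = y"
      using s by (simp add: field_simps power2_eq_square)
    moreover have "g (2 * ln s) = a * s - b / s"
      using s by (simp add: g_def exp_minus field_simps)
    ultimately show ?thesis by (metis rangeI)
  qed
  then have range: "range g = UNIV" by auto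
  have "(std_normal_density has_integral 1) UNIV"
    by (rule nn_integral_has_integral)
       (auto simp: nn_integral_eq_integral)
  then have "std_normal_density absolutely_integrable_on range g \<and> integral (range g) std_normal_density = 1"
    unfolding range
    by (intro conjI nonnegative_absolutely_integrable_1) (auto simp: integral_unique)
  then have "(\<lambda>w. \<bar>g' w\<bar> * std_normal_density (g w)) absolutely_integrable_on UNIV \<and>
      integral UNIV (\<lambda>w. \<bar>g' w\<bar> * std_normal_density (g w)) = 1"
    using deriv inj by (subst has_absolute_integral_change_of_variables_1') auto
  then have "((\<lambda>w. \<bar>g' w\<bar> * std_normal_density (g w)) has_integral 1) UNIV"
    using set_lebesgue_integral_eq_integral(1) by (metis has_integral_iff)
  then have "((\<lambda>w. g' w * std_normal_density (g w)) has_integral 1) UNIV"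
    using g'_pos by (simp add: abs_of_pos)
  then have "(\<integral>\<^sup>+w. g' w * std_normal_density (g w) \<partial>lborel) = ennreal 1"
    using g'_pos
    by (intro nn_integral_has_integral_lborel) (auto simp: g_def g'_def less_imp_le)
  then show ?thesis by (simp add: g_def g'_def)
qed

lemma nn_integral_log_inv_gaussian:
  assumes a: "a > 0" and b: "b > 0"
  shows "(\<integral>\<^sup>+w. log_inv_gaussian a b w \<partial>lborel) = 1"
proof -
  \<comment> \<open>Averaging with the reflection \<open>w \<mapsto> c - w\<close> makes the substitution lemma applicable.\<close>
  define c where "c = 2 * ln (b / a)"
  \<comment> \<open>This \<open>c\<close> makes the reflection exchange the two exponential terms.
    The squared difference is unchanged, while the prefactors of the two densities add up to twice
    the derivative in the substitution.\<close>
  have swap: "a * exp ((c - w) / 2) = b * exp (- w / 2)" "b * exp (- (c - w) / 2) = a * exp (w / 2)" for w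
  proof -
    have e: "(c - w) / 2 = ln (b / a) + (- w / 2)" "- (c - w) / 2 = ln (a / b) + w / 2"
      using a b by (simp_all add: c_def ln_div diff_divide_distrib)
    show "a * exp ((c - w) / 2) = b * exp (- w / 2)" "b * exp (- (c - w) / 2) = a * exp (w / 2)"
      unfolding e exp_add using a b by simp_all
  qed
  have refl: "log_inv_gaussian a b (c - w) =
      a / sqrt (2 * pi) * exp (w / 2) * exp (- (a * exp (w / 2) - b * exp (- w / 2))\<^sup>2 / 2)" for w
  proof -
    have "log_inv_gaussian a b (c - w) = (b * exp (- (c - w) / 2)) / sqrt (2 * pi) *
        exp (- (a * exp ((c - w) / 2) - b * exp (- (c - w) / 2))\<^sup>2 / 2)"
      by (simp add: log_inv_gaussian_def)
    also have "\<dots> = (a * exp (w / 2)) / sqrt (2 * pi) * exp (- (b * exp (- w / 2) - a * exp (w / 2))\<^sup>2 / 2)"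
      by (simp only: swap)
    also have "\<dots> = a / sqrt (2 * pi) * exp (w / 2) * exp (- (a * exp (w / 2) - b * exp (- w / 2))\<^sup>2 / 2)"
      by (subst power2_commute) simp
    finally show ?thesis .
  qed
  let ?I = "\<integral>\<^sup>+w. log_inv_gaussian a b w \<partial>lborel"
  have "?I + ?I = ?I + (\<integral>\<^sup>+w. log_inv_gaussian a b (c - w) \<partial>lborel)"
    by (subst nn_integral_lborel_reflect[of "\<lambda>w. ennreal (log_inv_gaussian a b w)"]) auto
  also have "\<dots> = (\<integral>\<^sup>+w. ennreal (log_inv_gaussian a b w) + ennreal (log_inv_gaussian a b (c - w)) \<partial>lborel)"
    by (subst nn_integral_add) auto
  also have "\<dots> = (\<integral>\<^sup>+w. 2 * ennreal ((a * exp (w / 2) + b * exp (- w / 2)) / 2 *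
           std_normal_density (a * exp (w / 2) - b * exp (- w / 2))) \<partial>lborel)"
  proof (rule nn_integral_cong)
    fix w
    have "log_inv_gaussian a b w + log_inv_gaussian a b (c - w) =
       2 * ((a * exp (w / 2) + b * exp (- w / 2)) / 2 *
           std_normal_density (a * exp (w / 2) - b * exp (- w / 2)))"
      unfolding refl unfolding log_inv_gaussian_def std_normal_density_def
      by (simp add: algebra_simps add_divide_distrib)
    moreover have "log_inv_gaussian a b v \<ge> 0" for v
      using b by (simp add: log_inv_gaussian_nonneg)
    ultimately show "ennreal (log_inv_gaussian a b w) + ennreal (log_inv_gaussian a b (c - w)) =
       2 * ennreal ((a * exp (w / 2) + b * exp (- w / 2)) / 2 *
           std_normal_density (a * exp (w / 2) - b * exp (- w / 2)))"
      by (metis ennreal_plus ennreal_mult' ennreal_numeral zero_le_numeral)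
  qed
  also have "\<dots> = 2 * (\<integral>\<^sup>+w. ((a * exp (w / 2) + b * exp (- w / 2)) / 2 *
           std_normal_density (a * exp (w / 2) - b * exp (- w / 2))) \<partial>lborel)"
    by (rule nn_integral_cmult) auto
  also have "\<dots> = 2"
    using nn_integral_std_normal_substitution[OF a b] by simp
  finally have "2 * ?I = 2 * 1" by (simp add: mult_2)
  then show ?thesis
    by (subst (asm) ennreal_mult_cancel_left) auto
qed

text \<open>Raise \<open>z \<le> exp z\<close> with \<open>z = c / q * y\<close> to the power
  \<open>q\<close>. The bound is uniform in \<open>y\<close>, so an exponential factor can absorb a
  power.\<close>

lemma powr_times_exp_le:
  fixes y q c :: real
  assumes "y \<ge> 0" "q > 0" "c > 0"
  shows "y powr q * exp (- c * y) \<le> (q / c) powr q"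
proof -
  have "c / q * y \<le> exp (c / q * y)"
    using exp_ge_add_one_self[of "c / q * y"] by linarith
  then have "y \<le> q / c * exp (c / q * y)"
    using assms by (simp add: field_simps)
  then have "y powr q \<le> (q / c * exp (c / q * y)) powr q"
    using assms by (intro powr_mono2) auto
  also have "\<dots> = (q / c) powr q * exp (c * y)"
    using assms by (subst powr_mult) (simp_all add: exp_powr_real)
  finally show ?thesis
    by (simp add: exp_minus field_simps)
qed

lemma log_inv_gaussian_expand:
  "log_inv_gaussian a b w =
     b / sqrt (2 * pi) * exp (- w / 2) * exp (a * b - a\<^sup>2 * exp w / 2 - b\<^sup>2 * exp (- w) / 2)"
proof -
  have "exp (w / 2) * exp (w / 2) = exp w" "exp (- w / 2) * exp (- w / 2) = exp (- w)"
    "exp (w / 2) * exp (- w / 2) = 1"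
    by (simp_all add: exp_add[symmetric])
  then have "(a * exp (w / 2) - b * exp (- w / 2))\<^sup>2 = a\<^sup>2 * exp w - 2 * a * b + b\<^sup>2 * exp (- w)"
    by (simp add: power2_eq_square left_diff_distrib right_diff_distrib mult_ac)
  then show ?thesis
    by (simp add: log_inv_gaussian_def diff_divide_distrib add_divide_distrib)
qed

text \<open>Splitting off half of one exponential factor leaves the same kind of density with another
  parameter, so that polynomial weights in \<open>exp w\<close> and \<open>exp (- w)\<close> can be absorbed.\<close>

lemma log_inv_gaussian_rate:
  "log_inv_gaussian a b w =
     exp (a * b - a / sqrt 2 * b) * log_inv_gaussian (a / sqrt 2) b w * exp (- a\<^sup>2 / 4 * exp w)"
proof -
  have "exp (a * b - a\<^sup>2 * exp w / 2 - b\<^sup>2 * exp (- w) / 2) =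
     exp (a * b - a / sqrt 2 * b) *
     exp (a / sqrt 2 * b - (a / sqrt 2)\<^sup>2 * exp w / 2 - b\<^sup>2 * exp (- w) / 2) * exp (- a\<^sup>2 / 4 * exp w)"
    unfolding exp_add[symmetric] by (simp add: power_divide)
  then show ?thesis unfolding log_inv_gaussian_expand by (simp only: mult_ac)
qed

lemma log_inv_gaussian_shape:
  "log_inv_gaussian a b w =
     sqrt 2 * exp (a * b - a * (b / sqrt 2)) * log_inv_gaussian a (b / sqrt 2) w * exp (- b\<^sup>2 / 4 * exp (- w))"
proof -
  have "exp (a * b - a\<^sup>2 * exp w / 2 - b\<^sup>2 * exp (- w) / 2) =
     exp (a * b - a * (b / sqrt 2)) *
     exp (a * (b / sqrt 2) - a\<^sup>2 * exp w / 2 - (b / sqrt 2)\<^sup>2 * exp (- w) / 2) * exp (- b\<^sup>2 / 4 * exp (- w))"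
    unfolding exp_add[symmetric] by (simp add: power_divide)
  then show ?thesis unfolding log_inv_gaussian_expand by simp
qed

section \<open>The Bessel function as a two-sided integral\<close>

lemma borel_measurable_cosh [measurable]: "(cosh :: real \<Rightarrow> real) \<in> borel_measurable borel"
  by (intro borel_measurable_continuous_onI continuous_intros)

text \<open>Averaging with the reflection of \<open>s\<close> replaces
  \<open>exp (- \<nu> * s)\<close> by the even function \<open>cosh (\<nu> * s)\<close>, and folding
  at 0 gives twice the half-line integral. Finiteness is assumed because \<open>besselK\<close> is a
  Bochner integral, which would otherwise default to 0.\<close>

lemma besselK_eq_nn_integral:
  assumes fin: "(\<integral>\<^sup>+s. ennreal (exp (- x * cosh s) * exp (- \<nu> * s)) \<partial>lborel) < \<infinity>"
  shows "(\<integral>\<^sup>+s. ennreal (exp (- x * cosh s) * exp (- \<nu> * s)) \<partial>lborel) = ennreal (2 * besselK \<nu> x)"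
    and "besselK \<nu> x \<ge> 0"
proof -
  let ?f = "\<lambda>s. exp (- x * cosh s) * exp (- \<nu> * s)"
  let ?h = "\<lambda>s. exp (- x * cosh s) * cosh (\<nu> * s)"
  let ?I = "\<integral>\<^sup>+s. ennreal (?f s) \<partial>lborel"
  let ?K = "\<integral>\<^sup>+s. ennreal (indicator {0..} s * ?h s) \<partial>lborel"
  have "?I + ?I = ?I + (\<integral>\<^sup>+s. ?f (0 - s) \<partial>lborel)"
    by (subst nn_integral_lborel_reflect[of "\<lambda>s. ennreal (?f s)"]) auto
  also have "\<dots> = (\<integral>\<^sup>+s. ennreal (?f s) + ennreal (?f (0 - s)) \<partial>lborel)"
    by (subst nn_integral_add) auto
  also have "\<dots> = (\<integral>\<^sup>+s. 2 * (ennreal (indicator {0..} s * ?h s) + ennreal (indicator {0..} (0 - s) * ?h (0 - s))) \<partial>lborel)"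
  \<comment> \<open>The two closed half-lines overlap at 0, so that null point is excluded.\<close>
  proof (rule nn_integral_cong_AE, rule AE_mp[OF AE_lborel_singleton[of 0]], rule AE_I2, rule impI)
    fix s :: real assume "s \<noteq> 0"
    have "?f s + ?f (0 - s) = 2 * ?h s"
      by (simp add: cosh_def algebra_simps)
    then have "ennreal (?f s) + ennreal (?f (0 - s)) = ennreal (2 * ?h s)"
      by (metis ennreal_plus exp_ge_zero mult_nonneg_nonneg)
    also have "\<dots> = 2 * ennreal (?h s)"
      by (simp add: ennreal_mult')
    also have "ennreal (?h s) = ennreal (indicator {0..} s * ?h s) + ennreal (indicator {0..} (0 - s) * ?h (0 - s))"
      using \<open>s \<noteq> 0\<close> by (auto simp: indicator_def)
    finally show "ennreal (?f s) + ennreal (?f (0 - s)) =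
        2 * (ennreal (indicator {0..} s * ?h s) + ennreal (indicator {0..} (0 - s) * ?h (0 - s)))" .
  qed
  also have "\<dots> = 2 * (?K + (\<integral>\<^sup>+s. ennreal (indicator {0..} (0 - s) * ?h (0 - s)) \<partial>lborel))"
    by (subst nn_integral_cmult) (auto simp: nn_integral_add)
  also have "(\<integral>\<^sup>+s. ennreal (indicator {0..} (0 - s) * ?h (0 - s)) \<partial>lborel) = ?K"
    by (rule nn_integral_lborel_reflect[of "\<lambda>s. ennreal (indicator {0..} s * ?h s)"]) auto
  finally have "2 * ?I = 2 * (2 * ?K)" by (simp add: mult_2)
  then have IK: "?I = 2 * ?K"
    by (subst (asm) ennreal_mult_cancel_left) auto
  have "?K < \<infinity>"
    using fin unfolding IK by (auto simp: ennreal_mult_less_top)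
  then have int: "integrable lborel (\<lambda>s. indicator {0..} s * ?h s)"
    by (intro integrableI_nonneg) (auto simp: cosh_real_nonneg)
  have K: "besselK \<nu> x = (\<integral>s. indicator {0..} s * ?h s \<partial>lborel)"
    by (simp add: besselK_def set_lebesgue_integral_def)
  show nn: "besselK \<nu> x \<ge> 0"
    unfolding K by (rule integral_nonneg_AE) (auto simp: cosh_real_nonneg)
  have "?K = ennreal (besselK \<nu> x)"
    unfolding K by (rule nn_integral_eq_integral[OF int]) (auto simp: cosh_real_nonneg)
  then show "?I = ennreal (2 * besselK \<nu> x)"
    unfolding IK by (simp add: ennreal_mult' nn)
qed

section \<open>The NDFHL density as a Gaussian mixture\<close>

text \<open>The joint density of the noise \<open>n\<close> and its log-variance \<open>w\<close>,
  for the normal variance mixture with unit scale: here \<open>exp w\<close> is inverse Gaussian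
  with mean \<open>lam / u\<close> and shape \<open>lam\<^sup>2\<close>.\<close>

definition ndfhl_mixture :: "real \<Rightarrow> real \<Rightarrow> 'a::euclidean_space \<Rightarrow> real \<Rightarrow> real" where
  "ndfhl_mixture lam u n w = log_inv_gaussian u lam w * isotropic_gaussian (exp w) n"

lemma measurable_ndfhl_mixture [measurable]:
  "(\<lambda>(n, w). ndfhl_mixture lam u n w) \<in> borel_measurable (borel \<Otimes>\<^sub>M borel)"
  unfolding ndfhl_mixture_def log_inv_gaussian_def isotropic_gaussian_def by measurable

text \<open>The shift balances the exponents: \<open>u\<^sup>2 * exp w\<close> and
  \<open>\<rho>\<^sup>2 * exp (- w)\<close> add up to \<open>2 * u * \<rho> * cosh s\<close>. The
  order \<open>\<nu>\<close> collects 1/2 from the mixing density and half the dimension from the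
  Gaussian normalisation.\<close>

lemma ndfhl_mixture_shift:
  fixes n :: "'a::euclidean_space"
  assumes lam: "lam > 0" and u: "u > 0"
  defines "\<rho> \<equiv> sqrt ((norm n)\<^sup>2 + lam\<^sup>2)" and "\<nu> \<equiv> (real DIM('a) + 1) / 2"
  shows "ndfhl_mixture lam u n (ln (\<rho> / u) + s) =
    lam * exp (lam * u) * (2 * pi) powr (- \<nu>) * (u / \<rho>) powr \<nu> *
      (exp (- (u * \<rho>) * cosh s) * exp (- \<nu> * s))"
proof -
  define w where "w = ln (\<rho> / u) + s"
  have \<rho>: "\<rho> > 0" using lam by (simp add: \<rho>_def add_nonneg_pos)
  have \<rho>2: "\<rho>\<^sup>2 = (norm n)\<^sup>2 + lam\<^sup>2" by (simp add: \<rho>_def)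
  have ew: "exp w = \<rho> / u * exp s" "exp (- w) = u / \<rho> * exp (- s)"
    using u \<rho> by (simp_all add: w_def exp_add exp_diff exp_minus field_simps)
  have gauss: "isotropic_gaussian (exp w) n =
      (2 * pi) powr (- real DIM('a) / 2) * exp (- real DIM('a) / 2 * w) * exp (- (norm n)\<^sup>2 * exp (- w) / 2)"
    by (simp add: isotropic_gaussian_def powr_mult exp_powr_real exp_minus field_simps)
  have "1 / sqrt (2 * pi) = (2 * pi) powr (- 1 / 2)"
    by (simp add: powr_minus_divide powr_half_sqrt)
  then have pis: "1 / sqrt (2 * pi) * (2 * pi) powr (- real DIM('a) / 2) = (2 * pi) powr (- \<nu>)"
    by (simp add: \<nu>_def powr_add[symmetric] add_divide_distrib algebra_simps)
  have e1: "exp (- w / 2) * exp (- real DIM('a) / 2 * w) = exp (- \<nu> * w)"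
    unfolding exp_add[symmetric] by (simp add: \<nu>_def field_simps)
  have e2: "exp (u * lam - u\<^sup>2 * exp w / 2 - lam\<^sup>2 * exp (- w) / 2) * exp (- (norm n)\<^sup>2 * exp (- w) / 2) =
      exp (lam * u) * exp (- (u * \<rho>) * cosh s)"
  proof -
    have "u * lam - u\<^sup>2 * exp w / 2 - lam\<^sup>2 * exp (- w) / 2 + (- (norm n)\<^sup>2 * exp (- w) / 2) =
       lam * u - (u\<^sup>2 * exp w + \<rho>\<^sup>2 * exp (- w)) / 2"
      unfolding \<rho>2 by (simp add: algebra_simps add_divide_distrib)
    also have "u\<^sup>2 * exp w + \<rho>\<^sup>2 * exp (- w) = u * \<rho> * (exp s + exp (- s))"
      unfolding ew using u \<rho> by (simp add: power2_eq_square field_simps)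
    also have "\<dots> = 2 * (u * \<rho> * cosh s)" by (simp add: cosh_def)
    finally show ?thesis unfolding exp_add[symmetric] by simp
  qed
  have e3: "exp (- \<nu> * w) = (u / \<rho>) powr \<nu> * exp (- \<nu> * s)"
  proof -
    have "exp (- \<nu> * w) = exp (- \<nu> * ln (\<rho> / u)) * exp (- \<nu> * s)"
      by (simp add: w_def algebra_simps exp_add[symmetric] exp_diff[symmetric])
    also have "exp (- \<nu> * ln (\<rho> / u)) = (u / \<rho>) powr \<nu>"
      using u \<rho> by (simp add: powr_def ln_div algebra_simps)
    finally show ?thesis .
  qed
  have "ndfhl_mixture lam u n w = lam * (1 / sqrt (2 * pi) * (2 * pi) powr (- real DIM('a) / 2)) *
     (exp (- w / 2) * exp (- real DIM('a) / 2 * w)) *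
     (exp (u * lam - u\<^sup>2 * exp w / 2 - lam\<^sup>2 * exp (- w) / 2) * exp (- (norm n)\<^sup>2 * exp (- w) / 2))"
    unfolding ndfhl_mixture_def log_inv_gaussian_expand gauss by simp
  also have "\<dots> = lam * (2 * pi) powr (- \<nu>) * ((u / \<rho>) powr \<nu> * exp (- \<nu> * s)) *
     (exp (lam * u) * exp (- (u * \<rho>) * cosh s))"
    unfolding pis e1 e2 e3 ..
  finally show ?thesis unfolding w_def by (simp only: mult_ac)
qed

text \<open>The Gaussian peak blows up as \<open>w\<close> tends to minus infinity, but the factor
  in \<open>exp (- w)\<close> split off by \<open>log_inv_gaussian_shape\<close> absorbs it, leaving
  \<open>K\<close> times a density of mass 1.\<close>

lemma ndfhl_mixture_bounded:
  fixes lam u :: real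
  assumes lam: "lam > 0" and u: "u > 0"
  obtains M where "M > 0" "\<And>n :: 'a::euclidean_space. (\<integral>\<^sup>+w. ndfhl_mixture lam u n w \<partial>lborel) \<le> ennreal M"
proof -
  define q where "q = real DIM('a) / 2"
  define K where "K = (2 * pi) powr (- q) * (q / (lam\<^sup>2 / 4)) powr q * (sqrt 2 * exp (u * lam - u * (lam / sqrt 2)))"
  have q: "q > 0" by (simp add: q_def)
  have K: "K > 0" using lam q by (simp add: K_def)
  have le: "ndfhl_mixture lam u n w \<le> K * log_inv_gaussian u (lam / sqrt 2) w" for n :: 'a and w
  proof -
    have "isotropic_gaussian (exp w) n \<le> (2 * pi * exp w) powr (- q)"
      unfolding isotropic_gaussian_def q_def
      by (simp add: mult_left_le)
    also have "\<dots> = (2 * pi) powr (- q) * exp (- w) powr q"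
      by (simp add: powr_mult exp_powr_real)
    finally have "ndfhl_mixture lam u n w \<le> log_inv_gaussian u lam w * ((2 * pi) powr (- q) * exp (- w) powr q)"
      using lam unfolding ndfhl_mixture_def by (intro mult_left_mono log_inv_gaussian_nonneg) auto
    also have "\<dots> = (2 * pi) powr (- q) * (sqrt 2 * exp (u * lam - u * (lam / sqrt 2))) *
        log_inv_gaussian u (lam / sqrt 2) w * (exp (- w) powr q * exp (- (lam\<^sup>2 / 4) * exp (- w)))"
      by (subst log_inv_gaussian_shape) simp
    also have "\<dots> \<le> (2 * pi) powr (- q) * (sqrt 2 * exp (u * lam - u * (lam / sqrt 2))) *
        log_inv_gaussian u (lam / sqrt 2) w * (q / (lam\<^sup>2 / 4)) powr q"
      using lam q
      by (intro mult_left_mono powr_times_exp_le mult_nonneg_nonneg log_inv_gaussian_nonneg) auto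
    finally show ?thesis by (simp add: K_def mult_ac)
  qed
  show ?thesis
  proof (rule that[OF K])
    fix n :: 'a
    have "(\<integral>\<^sup>+w. ndfhl_mixture lam u n w \<partial>lborel) \<le> (\<integral>\<^sup>+w. ennreal K * log_inv_gaussian u (lam / sqrt 2) w \<partial>lborel)"
      using le K by (intro nn_integral_mono) (simp add: ennreal_mult'[symmetric] ennreal_leI)
    also have "\<dots> = ennreal K"
      using lam u by (subst nn_integral_cmult) (auto simp: nn_integral_log_inv_gaussian)
    finally show "(\<integral>\<^sup>+w. ndfhl_mixture lam u n w \<partial>lborel) \<le> ennreal K" .
  qed
qed

lemma ndfhl_density_eq_mixture:
  fixes n :: "'a::euclidean_space"
  assumes lam: "lam > 0" and u: "u > 0" and d: "d = DIM('a) + 1"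
  shows "(\<integral>\<^sup>+w. ndfhl_mixture lam u n w \<partial>lborel) = ennreal (ndfhl_density d lam u (norm n))"
    and "ndfhl_density d lam u (norm n) \<ge> 0"
proof -
  define \<rho> where "\<rho> = sqrt ((norm n)\<^sup>2 + lam\<^sup>2)"
  define \<nu> where "\<nu> = (real DIM('a) + 1) / 2"
  define c where "c = lam * exp (lam * u) * (2 * pi) powr (- \<nu>) * (u / \<rho>) powr \<nu>"
  have \<rho>: "\<rho> > 0" using lam by (simp add: \<rho>_def add_nonneg_pos)
  have c: "c > 0" using lam u \<rho> by (simp add: c_def)
  let ?I = "\<integral>\<^sup>+s. exp (- (u * \<rho>) * cosh s) * exp (- \<nu> * s) \<partial>lborel"
  have "(\<integral>\<^sup>+w. ndfhl_mixture lam u n w \<partial>lborel) = (\<integral>\<^sup>+s. ndfhl_mixture lam u n (ln (\<rho> / u) + s) \<partial>lborel)"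
    by (rule nn_integral_lborel_translate[symmetric]) auto
  also have "\<dots> = (\<integral>\<^sup>+s. ennreal c * ennreal (exp (- (u * \<rho>) * cosh s) * exp (- \<nu> * s)) \<partial>lborel)"
    using c unfolding \<rho>_def by (subst ndfhl_mixture_shift[OF lam u])
      (simp add: c_def \<nu>_def \<rho>_def ennreal_mult'[symmetric])
  also have "\<dots> = ennreal c * ?I"
    by (rule nn_integral_cmult) auto
  finally have eq: "(\<integral>\<^sup>+w. ndfhl_mixture lam u n w \<partial>lborel) = ennreal c * ?I" .
  \<comment> \<open>The bound on the mixture supplies the finiteness required for the Bessel
    identity.\<close>
  obtain M where "(\<integral>\<^sup>+w. ndfhl_mixture lam u n w \<partial>lborel) \<le> ennreal M"
    using ndfhl_mixture_bounded[OF lam u] by metis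
  then have "ennreal c * ?I < \<infinity>"
    unfolding eq by (rule le_less_trans) simp
  then have fin: "?I < \<infinity>"
    using c by (auto simp: ennreal_mult_less_top)
  note K = besselK_eq_nn_integral[OF fin]
  have dens: "ndfhl_density d lam u (norm n) = c * (2 * besselK \<nu> (u * \<rho>))"
  proof -
    have \<nu>: "real d / 2 = \<nu>" by (simp add: d \<nu>_def)
    \<comment> \<open>The factor 2 from the two-sided Bessel integral accounts for the exponent
      \<open>\<nu> - 1\<close> of 2 in the density.\<close>
    have "2 * (2 * pi) powr (- \<nu>) = 1 / (2 powr (\<nu> - 1) * pi powr \<nu>)"
      by (simp add: powr_mult powr_minus_divide powr_diff)
    then have "c * 2 = lam / (2 powr (\<nu> - 1) * pi powr \<nu>) * (u / \<rho>) powr \<nu> * exp (lam * u)"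
      unfolding c_def by (simp add: field_simps)
    then show ?thesis
      unfolding ndfhl_density_def Let_def \<nu> \<rho>_def[symmetric] mult.assoc[symmetric] by simp
  qed
  show "(\<integral>\<^sup>+w. ndfhl_mixture lam u n w \<partial>lborel) = ennreal (ndfhl_density d lam u (norm n))"
    unfolding eq dens K(1) using c by (simp add: ennreal_mult')
  show "ndfhl_density d lam u (norm n) \<ge> 0"
    unfolding dens using c K(2) by simp
qed

text \<open>By Tonelli, integrals against the NDFHL density become averages of Gaussian integrals
  over the log-variance.\<close>

lemma nn_integral_ndfhl_density:
  assumes lam: "lam > 0" and u: "u > 0" and d: "d = DIM('a::euclidean_space) + 1"
    and [measurable]: "h \<in> borel_measurable borel"
  shows "(\<integral>\<^sup>+(n :: 'a). ennreal (ndfhl_density d lam u (norm n)) * h n \<partial>lborel) =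
    (\<integral>\<^sup>+w. ennreal (log_inv_gaussian u lam w) * (\<integral>\<^sup>+n. ennreal (isotropic_gaussian (exp w) n) * h n \<partial>lborel)
      \<partial>(lborel :: real measure))"
proof -
  have "(\<integral>\<^sup>+n. ennreal (ndfhl_density d lam u (norm n)) * h n \<partial>lborel) =
    (\<integral>\<^sup>+n. \<integral>\<^sup>+w. ennreal (ndfhl_mixture lam u n w) * h n \<partial>lborel \<partial>lborel)"
    by (simp add: ndfhl_density_eq_mixture(1)[OF lam u d, symmetric] nn_integral_multc)
  also have "\<dots> = (\<integral>\<^sup>+w. \<integral>\<^sup>+n. ennreal (ndfhl_mixture lam u n w) * h n \<partial>lborel \<partial>lborel)"
    by (rule lborel_pair.Fubini') auto
  also have "\<dots> = (\<integral>\<^sup>+w. \<integral>\<^sup>+n. ennreal (log_inv_gaussian u lam w) *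
      (ennreal (isotropic_gaussian (exp w) n) * h n) \<partial>lborel \<partial>lborel)"
    using lam by (simp add: ndfhl_mixture_def ennreal_mult' log_inv_gaussian_nonneg mult.assoc)
  also have "\<dots> = (\<integral>\<^sup>+w. ennreal (log_inv_gaussian u lam w) *
      (\<integral>\<^sup>+n. ennreal (isotropic_gaussian (exp w) n) * h n \<partial>lborel) \<partial>lborel)"
    by (intro nn_integral_cong nn_integral_cmult) auto
  finally show ?thesis .
qed

section \<open>Second moment and Gaussian minorant of the NDFHL density\<close>

text \<open>Half of the exponent is spent on the square, through
  \<open>y * exp (- (2 * y)) \<le> exp (- y)\<close>; the other half is a Gaussian of twice the
  variance. A bound linear in \<open>t\<close> on the second moment follows.\<close>

lemma square_times_gaussian_le:
  fixes n :: "'a::euclidean_space"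
  assumes t: "t > 0"
  shows "(norm n)\<^sup>2 * isotropic_gaussian t n \<le> 4 * 2 powr (DIM('a) / 2) * t * isotropic_gaussian (2 * t) n"
proof -
  let ?p = "- real DIM('a) / 2"
  define y where "y = (norm n)\<^sup>2 / (4 * t)"
  have "y \<le> exp y"
    using exp_ge_add_one_self[of y] by linarith
  then have "y * exp (- y) * exp (- y) \<le> 1 * exp (- y)"
    by (intro mult_right_mono) (auto simp: exp_minus field_simps)
  then have "y * exp (- (2 * y)) \<le> exp (- y)"
    by (simp add: mult.assoc exp_add[symmetric])
  then have le: "(2 * pi * t) powr ?p * (4 * t * (y * exp (- (2 * y)))) \<le> (2 * pi * t) powr ?p * (4 * t * exp (- y))"
    using t by (intro mult_left_mono) auto
  have y: "4 * t * y = (norm n)\<^sup>2" "- (norm n)\<^sup>2 / (2 * t) = - (2 * y)"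
      "- (norm n)\<^sup>2 / (2 * (2 * t)) = - y"
    using t by (simp_all add: y_def)
  have powr: "(2 * pi * t) powr ?p = 2 powr (DIM('a) / 2) * (2 * pi * (2 * t)) powr ?p"
  proof -
    have "(2 * pi * (2 * t)) powr ?p = 2 powr ?p * (2 * pi * t) powr ?p"
      using t by (subst powr_mult[symmetric]) (auto simp: mult_ac)
    then show ?thesis by (simp add: powr_minus_divide)
  qed
  have "(norm n)\<^sup>2 * isotropic_gaussian t n = (2 * pi * t) powr ?p * (4 * t * (y * exp (- (2 * y))))"
    unfolding isotropic_gaussian_def y(2) y(1)[symmetric] by simp
  also note le
  also have "(2 * pi * t) powr ?p * (4 * t * exp (- y)) =
      4 * 2 powr (DIM('a) / 2) * t * isotropic_gaussian (2 * t) n"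
    unfolding isotropic_gaussian_def y(3) powr by simp
  finally show ?thesis .
qed

lemma ndfhl_second_moment:
  assumes lam: "lam > 0" and u: "u > 0" and d: "d = DIM('a::euclidean_space) + 1"
  obtains S where "S \<ge> 0"
    "(\<integral>\<^sup>+(n :: 'a). (norm n)\<^sup>2 * ndfhl_density d lam u (norm n) \<partial>lborel) \<le> ennreal S"
proof -
  define a where "a = u / sqrt 2"
  define c where "c = 4 * 2 powr (DIM('a) / 2)"
  define S where "S = c * (exp (u * lam - a * lam) * (4 / u\<^sup>2))"
  have c: "c > 0" by (simp add: c_def)
  have S: "S \<ge> 0" using c by (simp add: S_def)
  have inner: "(\<integral>\<^sup>+(n :: 'a). ennreal (isotropic_gaussian (exp w) n) * ennreal ((norm n)\<^sup>2) \<partial>lborel)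
      \<le> ennreal (c * exp w)" for w
  proof -
    have "(\<integral>\<^sup>+(n :: 'a). ennreal (isotropic_gaussian (exp w) n) * ennreal ((norm n)\<^sup>2) \<partial>lborel)
      \<le> (\<integral>\<^sup>+(n :: 'a). ennreal (c * exp w) * ennreal (isotropic_gaussian (2 * exp w) n) \<partial>lborel)"
    proof (rule nn_integral_mono)
      fix n :: 'a
      have "ennreal ((norm n)\<^sup>2 * isotropic_gaussian (exp w) n) \<le>
          ennreal (c * exp w * isotropic_gaussian (2 * exp w) n)"
        using square_times_gaussian_le[of "exp w" n] by (intro ennreal_leI) (simp add: c_def)
      then show "ennreal (isotropic_gaussian (exp w) n) * ennreal ((norm n)\<^sup>2) \<le>
          ennreal (c * exp w) * ennreal (isotropic_gaussian (2 * exp w) n)"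
        using c by (simp add: ennreal_mult''[symmetric] ennreal_mult'[symmetric] mult.commute)
    qed
    also have "\<dots> = ennreal (c * exp w)"
      by (subst nn_integral_cmult) (auto simp: nn_integral_isotropic_gaussian)
    finally show ?thesis .
  qed
  have "(\<integral>\<^sup>+(n :: 'a). (norm n)\<^sup>2 * ndfhl_density d lam u (norm n) \<partial>lborel) =
     (\<integral>\<^sup>+(n :: 'a). ennreal (ndfhl_density d lam u (norm n)) * ennreal ((norm n)\<^sup>2) \<partial>lborel)"
    by (intro nn_integral_cong) (simp add: ennreal_mult''[symmetric] mult.commute)
  also have "\<dots> = (\<integral>\<^sup>+w. ennreal (log_inv_gaussian u lam w) *
      (\<integral>\<^sup>+(n :: 'a). ennreal (isotropic_gaussian (exp w) n) * ennreal ((norm n)\<^sup>2) \<partial>lborel) \<partial>lborel)"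
    by (rule nn_integral_ndfhl_density[OF lam u d]) auto
  also have "\<dots> \<le> (\<integral>\<^sup>+w. ennreal S * ennreal (log_inv_gaussian a lam w) \<partial>lborel)"
  proof (rule nn_integral_mono)
    fix w :: real
    \<comment> \<open>The Gaussian second moment contributes \<open>exp w\<close>, which is absorbed
      by the factor that \<open>log_inv_gaussian_rate\<close> splits off; the remaining density has
      rate \<open>a\<close>.\<close>
    have "exp w powr 1 * exp (- (u\<^sup>2 / 4) * exp w) \<le> (1 / (u\<^sup>2 / 4)) powr 1"
      using u by (intro powr_times_exp_le) auto
    then have "exp w * exp (- u\<^sup>2 / 4 * exp w) \<le> 4 / u\<^sup>2"
      using u by simp
    then have "c * exp (u * lam - a * lam) * log_inv_gaussian a lam w * (exp w * exp (- u\<^sup>2 / 4 * exp w))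
        \<le> c * exp (u * lam - a * lam) * log_inv_gaussian a lam w * (4 / u\<^sup>2)"
      using c lam by (intro mult_left_mono mult_nonneg_nonneg log_inv_gaussian_nonneg) auto
    then have le: "log_inv_gaussian u lam w * (c * exp w) \<le> S * log_inv_gaussian a lam w"
      unfolding log_inv_gaussian_rate[of u lam w] a_def S_def by (simp add: mult_ac)
    have "ennreal (log_inv_gaussian u lam w) *
      (\<integral>\<^sup>+(n :: 'a). ennreal (isotropic_gaussian (exp w) n) * ennreal ((norm n)\<^sup>2) \<partial>lborel)
      \<le> ennreal (log_inv_gaussian u lam w) * ennreal (c * exp w)"
      by (intro mult_left_mono inner) auto
    also have "\<dots> = ennreal (log_inv_gaussian u lam w * (c * exp w))"
      using c by (simp add: ennreal_mult'')
    also have "\<dots> \<le> ennreal (S * log_inv_gaussian a lam w)"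
      by (rule ennreal_leI[OF le])
    finally show "ennreal (log_inv_gaussian u lam w) *
      (\<integral>\<^sup>+(n :: 'a). ennreal (isotropic_gaussian (exp w) n) * ennreal ((norm n)\<^sup>2) \<partial>lborel)
      \<le> ennreal S * ennreal (log_inv_gaussian a lam w)"
      using S by (simp add: ennreal_mult')
  qed
  also have "\<dots> = ennreal S"
    using lam u by (subst nn_integral_cmult) (auto simp: nn_integral_log_inv_gaussian a_def)
  finally show ?thesis using that S by blast
qed

text \<open>Only log-variances in the unit interval are kept. There the variance is at least 1,
  hence the exponent 1/2, and the interval has length 1, so a pointwise minorant of the mixture
  survives integration unchanged.\<close>

lemma ndfhl_lower_bound:
  assumes lam: "lam > 0" and u: "u > 0" and d: "d = DIM('a::euclidean_space) + 1"
  obtains A where "A > 0" "\<And>n :: 'a. A * exp (- (1 / 2) * (norm n)\<^sup>2) \<le> ndfhl_density d lam u (norm n)"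
proof -
  \<comment> \<open>Each factor of the mixing density is replaced by a lower bound valid for
    \<open>w\<close> between 0 and 1.\<close>
  define K where "K = lam / sqrt (2 * pi) * exp (- 1 / 2) * exp (- (u * exp (1 / 2) + lam)\<^sup>2 / 2)"
  define A where "A = K * (2 * pi * exp 1) powr (- real DIM('a) / 2)"
  have K: "K > 0" using lam by (simp add: K_def)
  have A: "A > 0" using K by (simp add: A_def)
  have mix: "A * exp (- (1 / 2) * (norm n)\<^sup>2) \<le> ndfhl_mixture lam u n w"
    if w: "w \<in> {0..1}" for n :: 'a and w
  proof -
    have "\<bar>u * exp (w / 2) - lam * exp (- w / 2)\<bar> \<le> u * exp (w / 2) + lam * exp (- w / 2)"
      using u lam by (intro abs_leI) (auto simp: add_nonneg_nonneg)
    also have "\<dots> \<le> u * exp (1 / 2) + lam * 1"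
      using u lam w by (intro add_mono mult_left_mono) auto
    finally have "(u * exp (w / 2) - lam * exp (- w / 2))\<^sup>2 \<le> (u * exp (1 / 2) + lam)\<^sup>2"
      by (simp add: abs_le_square_iff[symmetric])
    then have 1: "K \<le> log_inv_gaussian u lam w"
      unfolding K_def log_inv_gaussian_def using w lam
      by (intro mult_mono mult_nonneg_nonneg) auto
    have "(2 * pi * exp 1) powr (- real DIM('a) / 2) \<le> (2 * pi * exp w) powr (- real DIM('a) / 2)"
      using w by (intro powr_mono2') auto
    moreover have "(norm n)\<^sup>2 * exp (- w) \<le> (norm n)\<^sup>2"
      using w by (intro mult_left_le) auto
    then have "exp (- (1 / 2) * (norm n)\<^sup>2) \<le> exp (- (norm n)\<^sup>2 / (2 * exp w))"
      by (simp add: exp_minus field_simps)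
    ultimately have 2: "(2 * pi * exp 1) powr (- real DIM('a) / 2) * exp (- (1 / 2) * (norm n)\<^sup>2)
        \<le> isotropic_gaussian (exp w) n"
      unfolding isotropic_gaussian_def by (intro mult_mono) auto
    have "K * ((2 * pi * exp 1) powr (- real DIM('a) / 2) * exp (- (1 / 2) * (norm n)\<^sup>2)) \<le>
        log_inv_gaussian u lam w * isotropic_gaussian (exp w) n"
      using 1 K lam by (intro mult_mono 2 log_inv_gaussian_nonneg) auto
    then show ?thesis
      by (simp only: A_def ndfhl_mixture_def mult.assoc[of K])
  qed
  show ?thesis
  proof (rule that[OF A])
    fix n :: 'a
    let ?r = "A * exp (- (1 / 2) * (norm n)\<^sup>2)"
    have "ennreal ?r = (\<integral>\<^sup>+w. ennreal ?r * indicator {0..1::real} w \<partial>lborel)"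
      by (subst nn_integral_cmult_indicator) auto
    also have "\<dots> \<le> (\<integral>\<^sup>+w. ndfhl_mixture lam u n w \<partial>lborel)"
      using mix by (intro nn_integral_mono) (auto simp: indicator_def intro!: ennreal_leI)
    also have "\<dots> = ennreal (ndfhl_density d lam u (norm n))"
      by (rule ndfhl_density_eq_mixture[OF lam u d])
    finally show "?r \<le> ndfhl_density d lam u (norm n)"
      using ndfhl_density_eq_mixture(2)[OF lam u d, of n] by simp
  qed
qed

lemma measurable_ndfhl_density [measurable]: "ndfhl_density d lam u \<in> borel_measurable borel"
  unfolding ndfhl_density_def besselK_def set_lebesgue_integral_def Let_def by measurable

section \<open>Capacity of the NDFHL channel\<close>

lemma noise_density_NDFHL:
  fixes lam u :: real
  assumes lam: "lam > 0" and u: "u > 0" and d: "d = CARD('n::finite) + 1"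
  obtains M S A B where "noise_density (\<lambda>n :: real^'n. ndfhl_density d lam u (norm n)) M S A B"
proof -
  have d': "d = DIM(real^'n) + 1" using d by simp
  obtain M where M: "M > 0" "\<And>n :: real^'n. (\<integral>\<^sup>+w. ndfhl_mixture lam u n w \<partial>lborel) \<le> ennreal M"
    using ndfhl_mixture_bounded[OF lam u] by blast
  obtain S where S: "S \<ge> 0"
    "(\<integral>\<^sup>+(n :: real^'n). (norm n)\<^sup>2 * ndfhl_density d lam u (norm n) \<partial>lborel) \<le> ennreal S"
    using ndfhl_second_moment[OF lam u d'] by blast
  obtain A where A: "A > 0"
    "\<And>n :: real^'n. A * exp (- (1 / 2) * (norm n)\<^sup>2) \<le> ndfhl_density d lam u (norm n)"
    using ndfhl_lower_bound[OF lam u d'] by blast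
  have "noise_density (\<lambda>n :: real^'n. ndfhl_density d lam u (norm n)) M S A (1 / 2)"
  proof
    show "ndfhl_density d lam u (norm n) \<le> M" for n :: "real^'n"
      using M(2)[of n] M(1) unfolding ndfhl_density_eq_mixture(1)[OF lam u d'] by simp
    \<comment> \<open>Total mass by the mixture formula with weight 1: each Gaussian has mass 1, and
      so does the mixing density.\<close>
    have "(\<integral>\<^sup>+(n :: real^'n). ndfhl_density d lam u (norm n) \<partial>lborel) =
        (\<integral>\<^sup>+w. ennreal (log_inv_gaussian u lam w) *
          (\<integral>\<^sup>+(n :: real^'n). ennreal (isotropic_gaussian (exp w) n) \<partial>lborel) \<partial>lborel)"
      using nn_integral_ndfhl_density[OF lam u d', of "\<lambda>_. 1"] by simp
    also have "\<dots> = 1"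
      by (simp add: nn_integral_isotropic_gaussian nn_integral_log_inv_gaussian lam u)
    finally show "(\<integral>\<^sup>+(n :: real^'n). ndfhl_density d lam u (norm n) \<partial>lborel) = 1" .
  qed (use A S in auto)
  then show ?thesis by (rule that)
qed

theorem theorem1:
  fixes d :: nat and lam u :: real
  assumes "d \<ge> 2" and "CARD('n::finite) = d - 1" and "lam > 0" and "u > 0"
  shows "eventually (\<lambda>P. capacity (NDFHL d lam u :: (real^'n) measure) P < \<infinity>) at_top \<and>
         (\<lambda>P. real_of_ereal (capacity (NDFHL d lam u :: (real^'n) measure) P)
                - real (d - 1) / 2 * ln P) \<in> O[at_top](\<lambda>_. 1)"
proof -
  \<comment> \<open>Since \<open>d \<ge> 2\<close>, the truncated subtraction \<open>d - 1\<close>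
    can be inverted.\<close>
  have "d = CARD('n) + 1" using assms by simp
  then obtain M S A B where
    "noise_density (\<lambda>n :: real^'n. ndfhl_density d lam u (norm n)) M S A B"
    using noise_density_NDFHL assms by blast
  then interpret noise_density "\<lambda>n :: real^'n. ndfhl_density d lam u (norm n)" M S A B .
  have "noise = NDFHL d lam u"
    by (simp add: noise_def NDFHL_def)
  then show ?thesis
    using capacity_asymptotics assms(2) by simp
qed

end
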